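(* Let $d>2$ be an integer. There is a constant $C_d$ such that for every prime $p$ and every set $\mathcal{O}$ of obstructing unit $d$-hypercubes in $[0,p]^d$, the number of hypercubes in $\mathcal{O}$ that are visible in the $d$-dimensional toy upper bound visibility environment is at most $C_d\,p^{d-\frac1d}\log p$.
   Context: The hypercube $[0,p]^d$ is partitioned into axis-aligned unit hypercubes $\prod_{i=1}^d[a_i,a_i+1]$ with $a_i\in\{0,\dots,p-1\}$; a set $\mathcal{O}$ of them is declared obstructing. For $t=(t_1,\dots,t_{d-1})\in\{0,\dots,p-1\}^{d-1}$ let $\mathcal{P}_t$ be the parallelotope with lower base $[0,1]^{d-1}\times\{0\}$ and lateral edges parallel to (and of the same length as) the segment $E_t$ joining the origin to the characteristic vertex $(t_1,\dots,t_{d-1},p)$. For each integer $0\le k<p$, let $$Q_{t,k}=\prod_{i=1}^{d-1}\Big[\big\lfloor \tfrac{t_ik}{p}\big\rfloor,\big\lfloor \tfrac{t_ik}{p}\big\rfloor+1\Big]\times[k,k+1]$$ be the unit hypercube at height $k$ whose bottom facet $F_{t,k}=Q_{t,k}\cap\{x_d=k\}$ meets $E_t$. Toy upper bound visibility environment: within each parallelotope $\mathcal{P}_t$ one considers only the obstructing hypercubes along $E_t$ (those of the form $Q_{t,k}$), and only the lines of sight parallel to the lateral edges of $\mathcal{P}_t$ starting from its lower base; hypercubes along $E_t$ are seen, and block such lines, through their bottom facets. Precisely, an obstructing hypercube $Q\in\mathcal{O}$ is visible in this environment if for some $t\in\{0,\dots,p-1\}^{d-1}$ and some $0\le k<p$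 we have $Q=Q_{t,k}$ and there is $x\in[0,1]^{d-1}$ such that the segment $\{(x,0)+s(t_1,\dots,t_{d-1},p): 0\le s\le 1\}$ meets $F_{t,k}$ and does not meet $F_{t,k'}$ for any $k'<k$ with $Q_{t,k'}\in\mathcal{O}$. *)

theory Defs
  imports Complex_Main "HOL-Library.FuncSet" "HOL-Computational_Algebra.Primes"
begin

text \<open>
  Points of \<open>\<real>\<^sup>n\<close> are extensional functions on \<open>{1..n}\<close>; since the dimensions \<open>d\<close> and
  \<open>d - 1\<close> occur together, they are kept as natural numbers rather than types.
\<close>

definition unit_cube :: "nat \<Rightarrow> (nat \<Rightarrow> int) \<Rightarrow> (nat \<Rightarrow> real) set" where
  "unit_cube d a = (\<Pi>\<^sub>E i\<in>{1..d}. {of_int (a i) .. of_int (a i) + 1})"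

definition cube_partition :: "nat \<Rightarrow> nat \<Rightarrow> (nat \<Rightarrow> real) set set" where
  "cube_partition d p = unit_cube d ` ({1..d} \<rightarrow>\<^sub>E {0..int p - 1})"

definition edge_cube :: "nat \<Rightarrow> nat \<Rightarrow> (nat \<Rightarrow> nat) \<Rightarrow> nat \<Rightarrow> (nat \<Rightarrow> real) set" where
  "edge_cube d p t k =
     unit_cube d (\<lambda>i. if i = d then int k else \<lfloor>real (t i) * real k / real p\<rfloor>)"

definition bottom_facet :: "nat \<Rightarrow> nat \<Rightarrow> (nat \<Rightarrow> nat) \<Rightarrow> nat \<Rightarrow> (nat \<Rightarrow> real) set" where
  "bottom_facet d p t k = {y \<in> edge_cube d p t k. y d = real k}"

text \<open>The segment \<open>{(x, 0) + s (t\<^sub>1, \<dots>, t\<^bsub>d-1\<^esub>, p) | 0 \<le> s \<le> 1}\<close>.\<close>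

definition sight_segment ::
    "nat \<Rightarrow> nat \<Rightarrow> (nat \<Rightarrow> nat) \<Rightarrow> (nat \<Rightarrow> real) \<Rightarrow> (nat \<Rightarrow> real) set" where
  "sight_segment d p t x =
     (\<lambda>s. \<lambda>i\<in>{1..d}. if i = d then s * real p else x i + s * real (t i)) ` {0..1}"

definition toy_visible ::
    "nat \<Rightarrow> nat \<Rightarrow> (nat \<Rightarrow> real) set set \<Rightarrow> (nat \<Rightarrow> real) set \<Rightarrow> bool" where
  "toy_visible d p \<O> Q \<longleftrightarrow>
     (\<exists>t \<in> {1..d-1} \<rightarrow>\<^sub>E {0..p-1}. \<exists>k<p. Q = edge_cube d p t k \<and>
        (\<exists>x \<in> {1..d-1} \<rightarrow>\<^sub>E {0..1}.
           sight_segment d p t x \<inter> bottom_facet d p t k \<noteq> {} \<and>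
           (\<forall>k'<k. edge_cube d p t k' \<in> \<O> \<longrightarrow>
              sight_segment d p t x \<inter> bottom_facet d p t k' = {})))"

end

theory Submission
  imports Defs "HOL-Analysis.Convex" "HOL-Analysis.Harmonic_Numbers"
begin

text \<open>
  Fix a direction \<open>t\<close> and attach to the height \<open>k\<close> the residues \<open>t\<^sub>i k mod p\<close>. A sight line starting at
  \<open>x\<close> meets the facet at height \<open>k\<close> iff \<open>x\<^sub>i \<le> 1 - (t\<^sub>i k mod p) / p\<close> for all \<open>i\<close>, so the visible heights
  form an antichain in the product order on the points \<open>(k, t\<^sub>1 k mod p, \<dots>, t\<^bsub>d-1\<^esub> k mod p)\<close>. If some
  \<open>q\<close> gives a point with all coordinates in \<open>[1, 2m]\<close>, then following translates by that
  point until they leave the box \<open>[0, p)\<^sup>d\<close> injects the antichain into the \<open>2dm\<close> points near the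
  upper faces. A second moment computation over all \<open>t\<close> shows that at most \<open>p\<^bsup>2(d-1)\<^esup> / m\<^sup>d\<close>
  directions have no such \<open>q\<close>. Hence the number of directions with more than \<open>j\<close> visible heights is
  \<open>O(p\<^bsup>d-1/d\<^esup> / j)\<close>, and summing over \<open>j < p\<close> gives the logarithm.
\<close>

section \<open>Residues modulo a prime and antichains of residue points\<close>

lemma nat_eq_if_int_dvd_diff:
  fixes x y p :: nat
  assumes "int p dvd int x - int y" "x < p" "y < p"
  shows "x = y"
proof -
  have "int x mod int p = int y mod int p" using assms(1) by (simp add: mod_eq_dvd_iff)
  then show ?thesis using assms(2,3) by simp
qed

lemma inj_on_mult_mod_prime:
  fixes p a :: nat
  assumes "prime p" "\<not> p dvd a"
  shows "inj_on (\<lambda>u. (a * u) mod p) {0..<p}"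
proof (rule inj_onI)
  fix u v assume uv: "u \<in> {0..<p}" "v \<in> {0..<p}" and "(a * u) mod p = (a * v) mod p"
  then have "int (a * u) mod int p = int (a * v) mod int p" by (metis of_nat_mod)
  then have "int p dvd int a * (int u - int v)" by (simp add: mod_eq_dvd_iff algebra_simps)
  then have "int p dvd int u - int v" using assms by (simp add: prime_dvd_mult_iff)
  then show "u = v" using uv by (simp add: nat_eq_if_int_dvd_diff)
qed

text \<open>Every \<open>k\<close> in \<open>S\<close> is pushed along translates by
  \<open>q\<close> and the residues of \<open>t i * q\<close> until it exits the box. Two elements
  with the same exit point differ by a multiple of this positive vector, so they are comparable,
  contrary to \<open>anti\<close>. Hence \<open>card S\<close> is at most the number of possible
  exit points.\<close>

lemma card_antichain_residues_le:
  fixes p q :: nat and t :: "'i \<Rightarrow> nat"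
  assumes p: "prime p" and I: "finite I" and q: "0 < q" "q < p"
    and pos: "\<And>i. i \<in> I \<Longrightarrow> 0 < (t i * q) mod p"
    and S: "S \<subseteq> {0..<p}"
    and anti: "\<And>k k'. k \<in> S \<Longrightarrow> k' \<in> S \<Longrightarrow> k' < k \<Longrightarrow>
       \<exists>i\<in>I. (t i * k) mod p < (t i * k') mod p"
  shows "card S \<le> q + (\<Sum>i\<in>I. (t i * q) mod p)"
proof -
  let ?r = "\<lambda>u i. (t i * u) mod p"
  define L where "L i = {u \<in> {0..<p}. p \<le> ?r u i + ?r q i}" for i
  define E where "E = {p - q..<p} \<union> (\<Union>i\<in>I. L i)"
  have p0: "p > 0" using p prime_gt_0_nat by blast
  have finL: "finite (L i)" for i by (simp add: L_def)
  have finE: "finite E" using I finL by (simp add: E_def)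
  have cardL: "card (L i) \<le> ?r q i" if i: "i \<in> I" for i
  proof -
    \<comment> \<open>A nonzero residue at \<open>q\<close> makes \<open>t i\<close> invertible
      modulo \<open>p\<close>. Multiplication by it then embeds \<open>L i\<close> into the top
      \<open>(t i * q) mod p\<close> residues.\<close>
    have "\<not> p dvd t i" using pos[OF i] by (metis dvd_mult2 dvd_imp_mod_0 less_irrefl)
    then have "inj_on (\<lambda>u. ?r u i) (L i)"
      by (intro inj_on_subset[OF inj_on_mult_mod_prime[OF p]]) (auto simp: L_def)
    moreover have "(\<lambda>u. ?r u i) ` L i \<subseteq> {p - ?r q i..<p}"
      using p0 by (auto simp: L_def)
    ultimately have "card (L i) \<le> card {p - ?r q i..<p}"
      by (meson card_inj_on_le finite_atLeastLessThan)
    also have "\<dots> = ?r q i" using p0 by (simp add: less_imp_le)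
    finally show ?thesis .
  qed
  have "card E \<le> card {p - q..<p} + card (\<Union>i\<in>I. L i)"
    unfolding E_def by (rule card_Un_le)
  also have "card (\<Union>i\<in>I. L i) \<le> (\<Sum>i\<in>I. card (L i))" by (rule card_UN_le[OF I])
  also have "\<dots> \<le> (\<Sum>i\<in>I. ?r q i)" by (rule sum_mono[OF cardL])
  finally have cardE: "card E \<le> q + (\<Sum>i\<in>I. ?r q i)" using q by simp
  \<comment> \<open>\<open>E\<close> is the part of the box that a translation by \<open>(q, ?r q)\<close> moves out of the box\<close>
  have exit_point: "\<exists>e\<in>E. \<exists>j. e = k + j * q \<and> (\<forall>i\<in>I. ?r e i = ?r k i + j * ?r q i)"
    if "k < p" for k
    using that
  proof (induction "p - k" arbitrary: k rule: less_induct)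
    case less
    show ?case
    proof (cases "k \<in> E")
      case True
      then show ?thesis by (intro bexI[of _ k] exI[of _ 0]) auto
    next
      case False
      then have kq: "k + q < p" and r: "\<And>i. i \<in> I \<Longrightarrow> ?r k i + ?r q i < p"
        using less.prems by (auto simp: E_def L_def not_le)
      \<comment> \<open>Outside \<open>E\<close> no coordinate wraps around, so residues add
        exactly; \<open>0 < q\<close> makes the distance \<open>p - k\<close> drop.\<close>
      have step: "?r (k + q) i = ?r k i + ?r q i" if "i \<in> I" for i
        using r[OF that] by (metis distrib_left mod_add_eq mod_less)
      have "p - (k + q) < p - k" using kq q by linarith
      from less.hyps[OF this kq] obtain e j where "e \<in> E" "e = (k + q) + j * q"
        "\<forall>i\<in>I. ?r e i = ?r (k + q) i + j * ?r q i" by blast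
      then show ?thesis using step by (intro bexI[of _ e] exI[of _ "Suc j"]) auto
    qed
  qed
  define R where "R k e \<longleftrightarrow> e \<in> E \<and> (\<exists>j. e = k + j * q \<and> (\<forall>i\<in>I. ?r e i = ?r k i + j * ?r q i))" for k e
  have "\<exists>e. R k e" if "k \<in> S" for k
  proof -
    have "k < p" using that S by auto
    then show ?thesis unfolding R_def using exit_point by blast
  qed
  then obtain g where g: "\<And>k. k \<in> S \<Longrightarrow> R k (g k)" by metis
  have no: False if k: "k \<in> S" "k' \<in> S" "k' < k" and eq: "g k = g k'" for k k'
  proof -
    obtain j where j: "g k = k + j * q" "\<forall>i\<in>I. ?r (g k) i = ?r k i + j * ?r q i"
      using g[OF k(1)] unfolding R_def by blast
    obtain j' where j': "g k = k' + j' * q" "\<forall>i\<in>I. ?r (g k) i = ?r k' i + j' * ?r q i"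
      using g[OF k(2)] eq unfolding R_def by metis
    \<comment> \<open>The lower start \<open>k'\<close> needs more steps to reach the common exit,
      so each of its residues is at most that of \<open>k\<close>.\<close>
    have "j * q < j' * q" using j(1) j'(1) k(3) by linarith
    then have jj: "j \<le> j'" by simp
    obtain i where i: "i \<in> I" "?r k i < ?r k' i" using anti[OF k] by blast
    have "j * ?r q i \<le> j' * ?r q i" using jj by simp
    moreover have "?r (g k) i = ?r k i + j * ?r q i" "?r (g k) i = ?r k' i + j' * ?r q i"
      using j(2) j'(2) i(1) by blast+
    ultimately show False using i(2) by linarith
  qed
  have "inj_on g S"
  proof (rule inj_onI)
    fix k k' assume "k \<in> S" "k' \<in> S" "g k = g k'"
    then show "k = k'" using no[of k k'] no[of k' k] by (cases k k' rule: linorder_cases) auto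
  qed
  moreover have "g ` S \<subseteq> E" using g by (auto simp: R_def)
  ultimately have "card S \<le> card E" using finE by (rule card_inj_on_le)
  with cardE show ?thesis by linarith
qed

section \<open>Geometry of sight lines for a fixed direction\<close>

lemma floor_add_mod_div:
  fixes a p :: nat
  assumes "p > 0"
  shows "real a / real p = of_int \<lfloor>real a / real p\<rfloor> + real (a mod p) / real p"
proof -
  have "real a = real (a div p) * real p + real (a mod p)"
    by (metis div_mult_mod_eq of_nat_add of_nat_mult)
  then have "real a / real p = real (a div p) + real (a mod p) / real p"
    using assms by (simp add: field_simps)
  moreover have "\<lfloor>real a / real p\<rfloor> = int (a div p)"
    by (rule floor_divide_of_nat_eq)
  ultimately show ?thesis by simp
qed

text \<open>The contribution of one direction to \<open>toy_visible\<close>, recorded by heights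
  instead of cubes so that residues can be attached to it.\<close>

definition visible_heights ::
    "nat \<Rightarrow> nat \<Rightarrow> (nat \<Rightarrow> real) set set \<Rightarrow> (nat \<Rightarrow> nat) \<Rightarrow> nat set" where
  "visible_heights d p \<O> t = {k. k < p \<and> edge_cube d p t k \<in> \<O> \<and>
     (\<exists>x \<in> {1..d-1} \<rightarrow>\<^sub>E {0..1}.
        sight_segment d p t x \<inter> bottom_facet d p t k \<noteq> {} \<and>
        (\<forall>k'<k. edge_cube d p t k' \<in> \<O> \<longrightarrow>
           sight_segment d p t x \<inter> bottom_facet d p t k' = {}))}"

text \<open>The last coordinate forces \<open>s = k / p\<close>. There the shift in coordinate
  \<open>i\<close> is its floor plus the residue divided by \<open>p\<close>; the lower bound of the
  facet holds because \<open>x i\<close> is nonnegative, and only the upper bound remains.\<close>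

lemma sight_segment_meets_bottom_facet_iff:
  assumes p: "p > 0" and d: "d > 0" and k: "k < p" and x: "x \<in> {1..d-1} \<rightarrow>\<^sub>E {0..1}"
  shows "sight_segment d p t x \<inter> bottom_facet d p t k \<noteq> {} \<longleftrightarrow>
         (\<forall>i\<in>{1..d-1}. x i + real ((t i * k) mod p) / real p \<le> 1)"
    (is "?L \<longleftrightarrow> ?R")
proof -
  let ?y = "\<lambda>s. \<lambda>i\<in>{1..d}. if i = d then s * real p else x i + s * real (t i)"
  let ?f = "\<lambda>i. of_int \<lfloor>real (t i) * real k / real p\<rfloor> :: real"
  have fl: "real k / real p * real (t i) = ?f i + real ((t i * k) mod p) / real p" for i
    using floor_add_mod_div[OF p, of "t i * k"] by (simp add: mult.commute)
  have s01: "real k / real p \<in> {0..1}" using p k by auto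
  have "?L \<longleftrightarrow> (\<exists>s\<in>{0..1}. ?y s \<in> bottom_facet d p t k)"
    unfolding sight_segment_def by blast
  also have "\<dots> \<longleftrightarrow> ?y (real k / real p) \<in> bottom_facet d p t k"
  proof
    assume "\<exists>s\<in>{0..1}. ?y s \<in> bottom_facet d p t k"
    then obtain s where s: "?y s \<in> bottom_facet d p t k" by blast
    then have "s * real p = real k" using d by (auto simp: bottom_facet_def)
    then have "s = real k / real p" using p by (simp add: field_simps)
    with s show "?y (real k / real p) \<in> bottom_facet d p t k" by (simp only:)
  qed (use s01 in blast)
  also have "\<dots> \<longleftrightarrow> (\<forall>i\<in>{1..d-1}. ?f i \<le> x i + real k / real p * real (t i) \<and>
      x i + real k / real p * real (t i) \<le> ?f i + 1)"
    using p d unfolding bottom_facet_def edge_cube_def unit_cube_def PiE_iff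
    by (auto split: if_splits)
  also have "\<dots> \<longleftrightarrow> ?R"
  proof (rule ball_cong[OF refl])
    fix i assume "i \<in> {1..d-1}"
    then have "0 \<le> x i" using x by (auto simp: PiE_iff)
    moreover have "0 \<le> real ((t i * k) mod p) / real p" by simp
    ultimately show "(?f i \<le> x i + real k / real p * real (t i) \<and>
      x i + real k / real p * real (t i) \<le> ?f i + 1) \<longleftrightarrow>
      x i + real ((t i * k) mod p) / real p \<le> 1" unfolding fl by linarith
  qed
  finally show ?thesis .
qed

text \<open>If no residue dropped from \<open>k'\<close> to \<open>k\<close>, every line reaching
  the facet at \<open>k\<close> would also meet the obstructing facet at \<open>k'\<close>, which
  lies below and would block it.\<close>

lemma visible_heights_antichain:
  assumes p: "p > 0" and d: "d > 0"
    and k: "k \<in> visible_heights d p \<O> t" and k': "k' \<in> visible_heights d p \<O> t" and "k' < k"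
  shows "\<exists>i\<in>{1..d-1}. (t i * k) mod p < (t i * k') mod p"
proof (rule ccontr)
  assume "\<not> ?thesis"
  then have le: "\<And>i. i \<in> {1..d-1} \<Longrightarrow> (t i * k') mod p \<le> (t i * k) mod p" by force
  obtain x where x: "x \<in> {1..d-1} \<rightarrow>\<^sub>E {0..1::real}"
    and meet: "sight_segment d p t x \<inter> bottom_facet d p t k \<noteq> {}"
    and "\<forall>k'<k. edge_cube d p t k' \<in> \<O> \<longrightarrow>
           sight_segment d p t x \<inter> bottom_facet d p t k' = {}"
    using k unfolding visible_heights_def by blast
  then have miss: "sight_segment d p t x \<inter> bottom_facet d p t k' = {}"
    using k' \<open>k' < k\<close> unfolding visible_heights_def by blast
  have kp: "k < p" "k' < p" using k k' by (auto simp: visible_heights_def)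
  have "x i + real ((t i * k') mod p) / real p \<le> 1" if i: "i \<in> {1..d-1}" for i
  proof -
    have "real ((t i * k') mod p) / real p \<le> real ((t i * k) mod p) / real p"
      using le[OF i] by (simp add: divide_right_mono)
    moreover have "x i + real ((t i * k) mod p) / real p \<le> 1"
      using meet sight_segment_meets_bottom_facet_iff[OF p d kp(1) x] i by blast
    ultimately show ?thesis by linarith
  qed
  then show False
    using miss sight_segment_meets_bottom_facet_iff[OF p d kp(2) x] by blast
qed

text \<open>Union bound over directions; a cube visible along several of them is counted
  repeatedly.\<close>

lemma card_toy_visible_le:
  assumes "p > 0"
  shows "card {Q \<in> \<O>. toy_visible d p \<O> Q}
    \<le> (\<Sum>t\<in>{1..d-1} \<rightarrow>\<^sub>E {0..p-1}. card (visible_heights d p \<O> t))"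
proof -
  let ?T = "{1..d-1} \<rightarrow>\<^sub>E {0..p-1}"
  let ?U = "\<Union>t\<in>?T. edge_cube d p t ` visible_heights d p \<O> t"
  have finT: "finite ?T" by (intro finite_PiE) auto
  have finV: "finite (visible_heights d p \<O> t)" for t
    by (rule finite_subset[of _ "{..<p}"]) (auto simp: visible_heights_def)
  have "{Q \<in> \<O>. toy_visible d p \<O> Q} \<subseteq> ?U"
    unfolding toy_visible_def visible_heights_def by blast
  then have "card {Q \<in> \<O>. toy_visible d p \<O> Q} \<le> card ?U"
    using finT finV by (intro card_mono) auto
  also have "\<dots> \<le> (\<Sum>t\<in>?T. card (edge_cube d p t ` visible_heights d p \<O> t))"
    by (rule card_UN_le[OF finT])
  also have "\<dots> \<le> (\<Sum>t\<in>?T. card (visible_heights d p \<O> t))"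
    by (intro sum_mono card_image_le finV)
  finally show ?thesis .
qed

section \<open>Collision counts and the second moment over all directions\<close>

lemma card_squared_le_card_image_mult_collisions:
  assumes "finite A"
  shows "(card A)\<^sup>2 \<le> card (f ` A) * card {(a, b) \<in> A \<times> A. f a = f b}"
proof -
  let ?F = "\<lambda>g. {a \<in> A. f a = g}"
  \<comment> \<open>Splitting colliding pairs by their common value gives the sum of squared fibre
    sizes, to which Cauchy-Schwarz applies.\<close>
  have "{(a, b) \<in> A \<times> A. f a = f b} = (\<Union>g\<in>f ` A. ?F g \<times> ?F g)" by auto
  then have "card {(a, b) \<in> A \<times> A. f a = f b} = (\<Sum>g\<in>f ` A. card (?F g \<times> ?F g))"
    using assms by (simp only:) (rule card_UN_disjoint, auto)
  then have pairs: "card {(a, b) \<in> A \<times> A. f a = f b} = (\<Sum>g\<in>f ` A. (card (?F g))\<^sup>2)"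
    by (simp add: card_cartesian_product power2_eq_square)
  have "A = (\<Union>g\<in>f ` A. ?F g)" by auto
  then have "card A = card (\<Union>g\<in>f ` A. ?F g)" by simp
  also have "\<dots> = (\<Sum>g\<in>f ` A. card (?F g))"
    using assms by (intro card_UN_disjoint) auto
  finally have "real (card A) = (\<Sum>g\<in>f ` A. real (card (?F g)))" by simp
  then have "(real (card A))\<^sup>2 \<le> (\<Sum>g\<in>f ` A. (real (card (?F g)))\<^sup>2) * real (card (f ` A))"
    using sum_squared_le_sum_of_squares[of "\<lambda>g. real (card (?F g))" "f ` A"] by simp
  then have "real ((card A)\<^sup>2) \<le> real (card (f ` A) * card {(a, b) \<in> A \<times> A. f a = f b})"
    unfolding pairs by (simp add: mult.commute)
  then show ?thesis by (simp only: of_nat_le_iff)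
qed

text \<open>This provides the translation vector for the antichain bound. Coordinates start at 1 so
  that each step strictly increases all of them; the bound \<open>2*m\<close> arises because such
  vectors are found as sums of two points of the box with coordinates in
  \<open>{1..m}\<close>.\<close>

definition short_multiplier :: "'i set \<Rightarrow> nat \<Rightarrow> nat \<Rightarrow> ('i \<Rightarrow> nat) \<Rightarrow> bool" where
  "short_multiplier I p m t \<longleftrightarrow> (\<exists>q\<in>{1..2*m}. \<forall>i\<in>I. (t i * q) mod p \<in> {1..2*m})"

text \<open>Two points lie in the same class iff their difference is congruent modulo \<open>p\<close> to a multiple of
  \<open>(1, t)\<close>; the first component of the pair is the height coordinate.\<close>

definition line_class :: "'i set \<Rightarrow> nat \<Rightarrow> ('i \<Rightarrow> nat) \<Rightarrow> nat \<times> ('i \<Rightarrow> nat) \<Rightarrow> 'i \<Rightarrow> int" where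
  "line_class I p t a = (\<lambda>i\<in>I. (int (snd a i) - int (t i) * int (fst a)) mod int p)"

lemma line_class_eq_iff:
  "line_class I p t a = line_class I p t b \<longleftrightarrow>
   (\<forall>i\<in>I. int p dvd (int (snd a i) - int (snd b i)) - int (t i) * (int (fst a) - int (fst b)))"
proof -
  have "line_class I p t a = line_class I p t b \<longleftrightarrow>
    (\<forall>i\<in>I. (int (snd a i) - int (t i) * int (fst a)) mod int p
         = (int (snd b i) - int (t i) * int (fst b)) mod int p)"
    by (auto simp: line_class_def restrict_def fun_eq_iff)
  then show ?thesis by (simp add: mod_eq_dvd_iff algebra_simps)
qed

text \<open>The classes of the box and of its negative are disjoint, so the box meets at most half of the
  classes and, by Cauchy--Schwarz, has twice the least possible number of collisions.\<close>

lemma collisions_ge_of_not_short_multiplier: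
  fixes p m :: nat
  assumes I: "finite I" and m: "2 * m < p" and bad: "\<not> short_multiplier I p m t"
  defines "A \<equiv> {1..m} \<times> (I \<rightarrow>\<^sub>E {1..m})"
  shows "2 * (card A)\<^sup>2 \<le>
    p ^ card I * card {(a, b) \<in> A \<times> A. line_class I p t a = line_class I p t b}"
proof -
  let ?c = "line_class I p t"
  let ?G = "I \<rightarrow>\<^sub>E {0..<int p}"
  let ?neg = "\<lambda>g. \<lambda>i\<in>I. (- g i) mod int p"
  have p0: "0 < p" using m by simp
  have finA: "finite A" using I by (simp add: A_def finite_PiE)
  have finG: "finite ?G" using I by (simp add: finite_PiE)
  have cardG: "card ?G = p ^ card I" using I by (simp add: card_PiE)
  have sub: "?c ` A \<subseteq> ?G" using p0 by (auto simp: line_class_def)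
  have negsub: "?neg ` ?c ` A \<subseteq> ?G" using p0 by auto
  have neg_neg: "?neg (?neg g) = g" if "g \<in> ?G" for g
    using that by (intro ext) (auto simp: PiE_iff extensional_def mod_minus_eq)
  have inj: "inj_on ?neg (?c ` A)"
    by (rule inj_on_inverseI[where g = ?neg], rule neg_neg) (use sub in blast)
  \<comment> \<open>If the class of \<open>a\<close> is the negative of the class of
    \<open>b\<close>, then the sum of \<open>a\<close> and \<open>b\<close> is congruent to a
    multiple of \<open>(1, t)\<close>. Its coordinates are at most \<open>2 * m < p\<close>, so they
    equal their residues and \<open>fst a + fst b\<close> is a short multiplier.\<close>
  have disj: "?c ` A \<inter> ?neg ` ?c ` A = {}"
  proof (rule ccontr)
    assume "\<not> ?thesis"
    then obtain a b where a: "a \<in> A" and b: "b \<in> A" and eq: "?c a = ?neg (?c b)" by blast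
    have "(t i * (fst a + fst b)) mod p = snd a i + snd b i" if i: "i \<in> I" for i
    proof -
      have "?c a i = ?neg (?c b) i" using eq by simp
      then have "(int (snd a i) - int (t i) * int (fst a)) mod int p
          = (- (int (snd b i) - int (t i) * int (fst b))) mod int p"
        using i by (simp add: line_class_def mod_minus_eq)
      then have "int p dvd (int (snd a i) + int (snd b i)) - int (t i) * (int (fst a) + int (fst b))"
        by (simp add: mod_eq_dvd_iff algebra_simps)
      then have "int (t i * (fst a + fst b)) mod int p = int (snd a i + snd b i) mod int p"
        by (simp add: mod_eq_dvd_iff dvd_diff_commute)
      then have "(t i * (fst a + fst b)) mod p = (snd a i + snd b i) mod p"
        by (metis of_nat_eq_iff of_nat_mod)
      moreover have "snd a i \<le> m" "snd b i \<le> m" using a b i by (auto simp: A_def)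
      ultimately show ?thesis using m by simp
    qed
    moreover have "snd a i + snd b i \<in> {1..2*m}" if "i \<in> I" for i
    proof -
      have "snd a i \<in> {1..m}" "snd b i \<in> {1..m}" using a b that by (auto simp: A_def)
      then show ?thesis by auto
    qed
    moreover have "fst a + fst b \<in> {1..2*m}" using a b by (auto simp: A_def)
    ultimately have "short_multiplier I p m t"
      unfolding short_multiplier_def by (intro bexI[of _ "fst a + fst b"]) auto
    with bad show False by blast
  qed
  have "2 * card (?c ` A) = card (?c ` A \<union> ?neg ` ?c ` A)"
    using finA disj inj by (simp add: card_Un_disjoint card_image)
  also have "\<dots> \<le> p ^ card I" using sub negsub finG cardG by (metis Un_least card_mono)
  finally have half: "2 * card (?c ` A) \<le> p ^ card I" .
  have "2 * (card A)\<^sup>2 \<le> 2 * (card (?c ` A) * card {(a, b) \<in> A \<times> A. ?c a = ?c b})"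
    by (intro mult_le_mono2 card_squared_le_card_image_mult_collisions finA)
  also have "\<dots> \<le> p ^ card I * card {(a, b) \<in> A \<times> A. ?c a = ?c b}"
    using mult_le_mono1[OF half] by (simp only: mult.assoc)
  finally show ?thesis .
qed

text \<open>The baseline valid in every direction: Cauchy-Schwarz with all \<open>p ^ card I\<close>
  classes available.\<close>

lemma collisions_ge:
  assumes I: "finite I" and p: "0 < p" and A: "finite A"
  shows "(card A)\<^sup>2 \<le>
    p ^ card I * card {(a, b) \<in> A \<times> A. line_class I p t a = line_class I p t b}"
proof -
  have "line_class I p t ` A \<subseteq> I \<rightarrow>\<^sub>E {0..<int p}" using p by (auto simp: line_class_def)
  then have "card (line_class I p t ` A) \<le> card (I \<rightarrow>\<^sub>E {0..<int p})"
    using I by (intro card_mono) (simp_all add: finite_PiE)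
  then have "card (line_class I p t ` A) \<le> p ^ card I" using I by (simp add: card_PiE)
  then show ?thesis
    using card_squared_le_card_image_mult_collisions[OF A, of "line_class I p t"]
    by (meson le_trans mult_le_mono1)
qed

text \<open>If the heights of \<open>a\<close> and \<open>b\<close> differ, their difference is
  invertible modulo \<open>p\<close> and the collision determines each \<open>t i\<close>. If the
  heights agree, a collision would force \<open>a = b\<close>, since all coordinates are below
  \<open>p\<close>.\<close>

lemma card_directions_collide_le_1:
  fixes p m :: nat
  assumes p: "prime p" and I: "finite I" and m: "m < p"
    and a: "a \<in> {1..m} \<times> (I \<rightarrow>\<^sub>E {1..m})" and b: "b \<in> {1..m} \<times> (I \<rightarrow>\<^sub>E {1..m})" and "a \<noteq> b"
  shows "card {t \<in> I \<rightarrow>\<^sub>E {0..p-1}. line_class I p t a = line_class I p t b} \<le> 1"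
proof -
  have "t = t'" if t: "t \<in> I \<rightarrow>\<^sub>E {0..p-1}" "line_class I p t a = line_class I p t b"
    and t': "t' \<in> I \<rightarrow>\<^sub>E {0..p-1}" "line_class I p t' a = line_class I p t' b" for t t'
  proof (cases "fst a = fst b")
    case True
    have "snd a i = snd b i" if i: "i \<in> I" for i
    proof (rule nat_eq_if_int_dvd_diff)
      show "int p dvd int (snd a i) - int (snd b i)"
        using t(2) i True by (simp add: line_class_eq_iff)
      show "snd a i < p" "snd b i < p" using a b i m by (auto simp: PiE_iff) force+
    qed
    then have "snd a = snd b" using a b by (intro PiE_ext[of _ I "\<lambda>_. {1..m}"]) auto
    with True \<open>a \<noteq> b\<close> show ?thesis by (simp add: prod_eq_iff)
  next
    case False
    have nd: "\<not> int p dvd int (fst a) - int (fst b)"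
      using nat_eq_if_int_dvd_diff[of p "fst a" "fst b"] False a b m by auto
    show ?thesis
    proof (rule PiE_ext[OF t(1) t'(1)])
      fix i assume i: "i \<in> I"
      let ?D = "int (snd a i) - int (snd b i)" and ?e = "int (fst a) - int (fst b)"
      have "int p dvd ?D - int (t i) * ?e" "int p dvd ?D - int (t' i) * ?e"
        using t(2) t'(2) i by (auto simp: line_class_eq_iff)
      then have "int p dvd (?D - int (t' i) * ?e) - (?D - int (t i) * ?e)" by (rule dvd_diff[rotated])
      then have "int p dvd (int (t i) - int (t' i)) * ?e" by (simp add: algebra_simps)
      then have "int p dvd int (t i) - int (t' i)" using p nd by (simp add: prime_dvd_mult_iff)
      moreover have "t i < p" "t' i < p"
        using t(1) t'(1) i prime_gt_0_nat[OF p] by (auto simp: PiE_iff)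
      ultimately show "t i = t' i" using nat_eq_if_int_dvd_diff by blast
    qed
  qed
  moreover have "finite {t \<in> I \<rightarrow>\<^sub>E {0..p-1}. line_class I p t a = line_class I p t b}"
    using I by (simp add: finite_PiE)
  ultimately show ?thesis by (auto simp: card_le_Suc0_iff_eq)
qed

text \<open>Directions without a short multiplier have at least twice the baseline number of
  collisions. Double counting shows that the total exceeds the baseline by at most the diagonal term
  \<open>card A * n\<close>, so few such directions exist.\<close>

lemma card_not_short_multiplier_mult_le:
  fixes p m :: nat
  assumes p: "prime p" and I: "finite I" and m: "2 * m < p" "0 < m"
  shows "card {t \<in> I \<rightarrow>\<^sub>E {0..p-1}. \<not> short_multiplier I p m t} * m ^ Suc (card I)
           \<le> (p ^ card I)\<^sup>2"
proof -
  define A where "A = {1..m} \<times> (I \<rightarrow>\<^sub>E {1..m})"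
  define T where "T = I \<rightarrow>\<^sub>E {0..p-1}"
  define B where "B = {t \<in> T. \<not> short_multiplier I p m t}"
  define n where "n = p ^ card I"
  define coll where "coll t = card {(a, b) \<in> A \<times> A. line_class I p t a = line_class I p t b}" for t
  have p0: "0 < p" using p prime_gt_0_nat by blast
  have finA: "finite A" using I by (simp add: A_def finite_PiE)
  have cardA: "card A = m ^ Suc (card I)" using I by (simp add: A_def card_PiE card_cartesian_product)
  have finT: "finite T" using I by (simp add: T_def finite_PiE)
  have cardT: "card T = n" using I p0 by (simp add: T_def n_def card_PiE)
  have BT: "B \<subseteq> T" by (auto simp: B_def)
  have "(\<Sum>t\<in>T. coll t) = (\<Sum>t\<in>T. \<Sum>z\<in>A \<times> A. if line_class I p t (fst z) = line_class I p t (snd z) then 1 else 0)"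
    unfolding coll_def using finA
    by (intro sum.cong refl) (auto simp: sum.If_cases intro!: arg_cong[where f = card])
  also have "\<dots> = (\<Sum>z\<in>A \<times> A. card {t \<in> T. line_class I p t (fst z) = line_class I p t (snd z)})"
    using finT by (subst sum.swap) (simp add: sum.If_cases Collect_conj_eq)
  \<comment> \<open>Diagonal pairs collide in all \<open>n\<close> directions, other pairs in at
    most one; the extra 1 on the diagonal is slack that keeps the sum simple.\<close>
  also have "\<dots> \<le> (\<Sum>z\<in>A \<times> A. (if fst z = snd z then n else 0) + 1)"
  proof (rule sum_mono)
    fix z assume z: "z \<in> A \<times> A"
    show "card {t \<in> T. line_class I p t (fst z) = line_class I p t (snd z)}
      \<le> (if fst z = snd z then n else 0) + 1"
    proof (cases "fst z = snd z")
      case True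
      then show ?thesis using cardT by simp
    next
      case False
      then show ?thesis
        using card_directions_collide_le_1[OF p I, of m "fst z" "snd z"] z m
        by (auto simp: A_def T_def)
    qed
  qed
  also have "\<dots> = (\<Sum>a\<in>A. \<Sum>b\<in>A. if a = b then n else 0) + card (A \<times> A)"
    by (simp add: sum_Suc sum.cartesian_product case_prod_unfold)
  also have "\<dots> = card A * n + (card A)\<^sup>2"
    using finA by (simp add: card_cartesian_product power2_eq_square)
  finally have total: "(\<Sum>t\<in>T. coll t) \<le> card A * n + (card A)\<^sup>2" .
  have "n * (card A)\<^sup>2 + card B * (card A)\<^sup>2 = (\<Sum>t\<in>T. (card A)\<^sup>2 + (if t \<in> B then (card A)\<^sup>2 else 0))"
    using finT BT cardT by (simp add: sum.distrib sum.If_cases Int_absorb1)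
  also have "\<dots> \<le> (\<Sum>t\<in>T. n * coll t)"
  proof (rule sum_mono)
    fix t assume "t \<in> T"
    show "(card A)\<^sup>2 + (if t \<in> B then (card A)\<^sup>2 else 0) \<le> n * coll t"
      using collisions_ge[OF I p0 finA, of t]
        collisions_ge_of_not_short_multiplier[OF I m(1), of t]
      by (auto simp: B_def n_def coll_def A_def)
  qed
  also have "\<dots> \<le> n * (card A * n + (card A)\<^sup>2)"
    using total by (simp add: sum_distrib_left[symmetric])
  \<comment> \<open>The baseline \<open>n * (card A)\<^sup>2\<close> cancels from both sides,
    leaving only the surplus of \<open>B\<close> and the diagonal.\<close>
  finally have "(card B * card A) * card A \<le> n\<^sup>2 * card A"
    by (simp add: algebra_simps power2_eq_square)
  moreover have "0 < card A" using m cardA by simp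
  ultimately have "card B * card A \<le> n\<^sup>2" by simp
  then show ?thesis by (simp add: B_def T_def cardA n_def)
qed

section \<open>Directions with many visible heights and the final summation\<close>

lemma card_visible_heights_le:
  assumes p: "prime p" and d: "0 < d" and m: "2 * m < p"
    and short: "short_multiplier {1..d-1} p m t"
  shows "card (visible_heights d p \<O> t) \<le> 2 * d * m"
proof -
  obtain q where q: "q \<in> {1..2*m}" and r: "\<forall>i\<in>{1..d-1}. (t i * q) mod p \<in> {1..2*m}"
    using short unfolding short_multiplier_def by blast
  have "card (visible_heights d p \<O> t) \<le> q + (\<Sum>i\<in>{1..d-1}. (t i * q) mod p)"
  proof (rule card_antichain_residues_le[OF p])
    show "visible_heights d p \<O> t \<subseteq> {0..<p}" by (auto simp: visible_heights_def)
    show "\<exists>i\<in>{1..d-1}. (t i * k) mod p < (t i * k') mod p"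
      if "k \<in> visible_heights d p \<O> t" "k' \<in> visible_heights d p \<O> t" "k' < k" for k k'
      using visible_heights_antichain[OF prime_gt_0_nat[OF p] d that] .
  qed (use q r m in force)+
  also have "(\<Sum>i\<in>{1..d-1}. (t i * q) mod p) \<le> (\<Sum>i\<in>{1..d-1}. 2 * m)"
    using r by (intro sum_mono) auto
  also have "q \<le> 2 * m" using q by simp
  finally have "card (visible_heights d p \<O> t) \<le> 2 * m + (d - 1) * (2 * m)" by simp
  also have "\<dots> = 2 * d * m" using d by (cases d) auto
  finally show ?thesis .
qed

text \<open>The difference between the harmonic number and the logarithm decreases from its value 1
  at \<open>n = 1\<close>.\<close>

lemma sum_inverse_le_ln:
  assumes "0 < n"
  shows "(\<Sum>j=1..n. 1 / real j) \<le> 1 + ln (real n)"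
proof -
  have "harm (Suc (n - 1)) - ln (real (Suc (n - 1))) \<le> harm (Suc 0) - ln (real (Suc 0))"
    using decseqD[OF decseq_harm_diff_ln, of 0 "n - 1"] by simp
  then show ?thesis using assms by (simp add: harm_def inverse_eq_divide)
qed

text \<open>With \<open>m\<close> about \<open>j / (2 * d)\<close>, more than \<open>j\<close>
  visible heights exclude a short multiplier. The resulting bound \<open>n\<^sup>2 / m ^ d\<close>
  is combined with the trivial bound \<open>n\<close>.\<close>

lemma card_many_visible_heights_le:
  assumes p: "prime p" and d: "0 < d" and j: "1 \<le> j" "j < p"
  shows "real (card {t \<in> {1..d-1} \<rightarrow>\<^sub>E {0..p-1}. j < card (visible_heights d p \<O> t)})
    \<le> 4 * real d * real p ^ (d - 1) * real p powr (1 - 1 / real d) / real j"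
proof -
  define T where "T = {1..d-1} \<rightarrow>\<^sub>E {0..p-1}"
  define J where "J = {t \<in> T. j < card (visible_heights d p \<O> t)}"
  define n where "n = real p ^ (d - 1)"
  define M where "M = real p powr (1 - 1 / real d)"
  have p0: "0 < p" using p by (rule prime_gt_0_nat)
  then have p1: "1 \<le> real p" by simp
  have n0: "0 < n" using p0 by (simp add: n_def)
  \<comment> \<open>\<open>M\<close> is the \<open>d\<close>-th root of \<open>n\<close>, the size
    of \<open>m\<close> at which the bounds \<open>n\<close> and \<open>n\<^sup>2 / m ^ d\<close>
    coincide.\<close>
  have M1: "1 \<le> M" unfolding M_def using p1 d by (intro ge_one_powr_ge_zero) auto
  have nM: "n = M ^ d"
  proof -
    have "M ^ d = real p powr ((1 - 1 / real d) * real d)"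
      using p0 by (simp add: M_def powr_realpow[symmetric] powr_powr)
    also have "(1 - 1 / real d) * real d = real (d - 1)" using d by (simp add: field_simps of_nat_diff)
    finally show ?thesis using p0 by (simp add: n_def powr_realpow)
  qed
  have finT: "finite T" unfolding T_def by (intro finite_PiE) auto
  have cardT: "real (card T) = n" using p0 by (simp add: T_def n_def card_PiE)
  have Jn: "real (card J) \<le> n"
    using card_mono[OF finT, of J] cardT by (simp add: J_def)
  have "real (card J) \<le> 4 * real d * n * M / real j"
  proof (cases "j < 2 * d")
    \<comment> \<open>Here \<open>j div (2 * d)\<close> would be 0, but \<open>j\<close> is so small
      that the trivial bound \<open>n\<close> suffices.\<close>
    case True
    then have "real j \<le> 4 * real d * M"
      using M1 mult_mono[of "real j" "4 * real d" 1 M] by simp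
    then have "n * real j \<le> n * (4 * real d * M)" using n0 by simp
    then have "n \<le> 4 * real d * n * M / real j" using j by (simp add: field_simps)
    with Jn show ?thesis by linarith
  next
    case False
    define m where "m = j div (2 * d)"
    have m0: "0 < m" using False d by (simp add: m_def div_greater_zero_iff)
    have mj: "2 * d * m \<le> j" by (simp add: m_def)
    have "2 * m \<le> 2 * d * m" using d by simp
    then have mp: "2 * m < p" using mj j by linarith
    \<comment> \<open>Rounding down in \<open>m\<close> costs at most a factor 2 because
      \<open>m\<close> is positive; this is the origin of the 4.\<close>
    have "j < 2 * d * m + 2 * d"
      using d dividend_less_times_div[of "2 * d" j] by (simp add: m_def)
    also have "\<dots> \<le> 4 * d * m" using m0 d by (cases m) auto
    finally have "real j \<le> real (4 * d * m)" unfolding of_nat_le_iff by (rule less_imp_le)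
    then have jm: "real j \<le> 4 * real d * real m" by simp
    let ?B = "{t \<in> T. \<not> short_multiplier {1..d-1} p m t}"
    have "J \<subseteq> ?B"
    proof
      fix t assume t: "t \<in> J"
      have "\<not> short_multiplier {1..d-1} p m t"
        using card_visible_heights_le[OF p d mp, of t \<O>] mj t by (auto simp: J_def)
      with t show "t \<in> ?B" by (simp add: J_def)
    qed
    then have "card J \<le> card ?B" using finT by (intro card_mono) auto
    then have "card J * m ^ d \<le> card ?B * m ^ d" by simp
    also have "\<dots> \<le> (p ^ (d - 1))\<^sup>2"
      using card_not_short_multiplier_mult_le[OF p _ mp m0, of "{1..d-1}"] d by (simp add: T_def)
    finally have "real (card J * m ^ d) \<le> real ((p ^ (d - 1))\<^sup>2)" by (simp only: of_nat_le_iff)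
    then have le: "real (card J) * real m ^ d \<le> n * M ^ d"
      by (simp add: nM[symmetric] power2_eq_square) (simp add: n_def)
    \<comment> \<open>For \<open>m\<close> up to \<open>M\<close> the trivial bound is enough;
      beyond \<open>M\<close>, the factor \<open>(M / m) ^ d\<close> is at most
      \<open>M / m\<close>.\<close>
    have "real (card J) * real m \<le> n * M"
    proof (cases "real m \<le> M")
      case True
      then show ?thesis using Jn n0 by (intro mult_mono) auto
    next
      case False
      then have "M ^ (d - 1) \<le> real m ^ (d - 1)" using M1 by (intro power_mono) auto
      have "(real (card J) * real m) * real m ^ (d - 1) = real (card J) * real m ^ d"
        using d by (cases d) auto
      also have "\<dots> \<le> n * M * M ^ (d - 1)" using le d by (cases d) auto
      also have "\<dots> \<le> n * M * real m ^ (d - 1)"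
        using \<open>M ^ (d - 1) \<le> real m ^ (d - 1)\<close> n0 M1 by (intro mult_left_mono) auto
      finally show ?thesis using m0 by simp
    qed
    then have "4 * real d * (real (card J) * real m) \<le> 4 * real d * (n * M)" by (intro mult_left_mono) auto
    moreover have "real (card J) * real j \<le> real (card J) * (4 * real d * real m)"
      using jm by (intro mult_left_mono) auto
    ultimately show ?thesis using j by (simp add: field_simps)
  qed
  then show ?thesis by (simp add: J_def T_def n_def M_def)
qed

theorem theorem7p2:
  fixes d :: nat
  assumes "d > 2"
  shows "\<exists>C::real. \<forall>p::nat. prime p \<longrightarrow>
           (\<forall>\<O>. \<O> \<subseteq> cube_partition d p \<longrightarrow>
              real (card {Q \<in> \<O>. toy_visible d p \<O> Q})
                \<le> C * real p powr (real d - 1 / real d) * ln (real p))"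
proof (intro exI[of _ "12 * real d + 2"] allI impI)
  fix p :: nat and \<O> :: "(nat \<Rightarrow> real) set set"
  assume p: "prime p"
  have d: "0 < d" using assms by simp
  define T where "T = {1..d-1} \<rightarrow>\<^sub>E {0..p-1}"
  define f where "f t = card (visible_heights d p \<O> t)" for t
  define n where "n = real p ^ (d - 1)"
  define M where "M = real p powr (1 - 1 / real d)"
  define c where "c = 4 * real d * n * M"
  have p2: "2 \<le> p" using p by (rule prime_ge_2_nat)
  have finT: "finite T" unfolding T_def by (intro finite_PiE) auto
  have cardT: "real (card T) = n" using p2 by (simp add: T_def n_def card_PiE)
  have n0: "0 \<le> n" by (simp add: n_def)
  have M1: "1 \<le> M" unfolding M_def using p2 d by (intro ge_one_powr_ge_zero) auto
  have c0: "0 \<le> c" using n0 M1 by (simp add: c_def)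
  have fp: "f t \<le> p" for t
    unfolding f_def by (rule order_trans[OF card_mono[of "{..<p}"]]) (auto simp: visible_heights_def)
  \<comment> \<open>Layer-cake decomposition: summing the sizes of the level sets over
    \<open>j\<close> recovers the sum of \<open>f\<close>.\<close>
  have "f t = (\<Sum>j<p. if j < f t then 1 else 0)" for t
  proof -
    have "{..<p} \<inter> {j. j < f t} = {..<f t}" using fp[of t] by auto
    then show ?thesis by (simp add: sum.If_cases)
  qed
  then have "(\<Sum>t\<in>T. f t) = (\<Sum>t\<in>T. \<Sum>j<p. if j < f t then 1 else 0)" by (rule sum.cong[OF refl])
  also have "\<dots> = (\<Sum>j<p. card {t \<in> T. j < f t})"
    using finT by (subst sum.swap) (simp add: sum.If_cases Collect_conj_eq)
  finally have layers: "(\<Sum>t\<in>T. f t) = (\<Sum>j<p. card {t \<in> T. j < f t})" .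
  have split: "{..<p} = insert 0 {1..p-1}" using p2 by auto
  have "real (card {Q \<in> \<O>. toy_visible d p \<O> Q}) \<le> real (\<Sum>t\<in>T. f t)"
    using card_toy_visible_le[of p \<O> d] p2 by (simp only: of_nat_le_iff T_def f_def)
  also have "\<dots> = real (card {t \<in> T. 0 < f t}) + (\<Sum>j=1..p-1. real (card {t \<in> T. j < f t}))"
    unfolding layers split by (subst sum.insert) auto
  \<comment> \<open>The layer \<open>j = 0\<close> is bounded by the number of directions, since the
    tail estimate requires \<open>1 \<le> j\<close>.\<close>
  also have "\<dots> \<le> n + (\<Sum>j=1..p-1. c * (1 / real j))"
  proof (intro add_mono sum_mono)
    show "real (card {t \<in> T. 0 < f t}) \<le> n"
      using card_mono[OF finT, of "{t \<in> T. 0 < f t}"] cardT by simp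
    show "real (card {t \<in> T. j < f t}) \<le> c * (1 / real j)" if "j \<in> {1..p-1}" for j
      using card_many_visible_heights_le[OF p d, of j \<O>] that
      by (auto simp: T_def f_def c_def n_def M_def)
  qed
  also have "\<dots> = n + c * (\<Sum>j=1..p-1. 1 / real j)" by (simp only: sum_distrib_left)
  also have "\<dots> \<le> n * M + c * (1 + ln (real p))"
  proof -
    have "(\<Sum>j=1..p-1. 1 / real j) \<le> 1 + ln (real (p - 1))" using p2 by (intro sum_inverse_le_ln) auto
    also have "\<dots> \<le> 1 + ln (real p)" using p2 by simp
    finally have "c * (\<Sum>j=1..p-1. 1 / real j) \<le> c * (1 + ln (real p))"
      using c0 by (intro mult_left_mono)
    moreover have "n * 1 \<le> n * M" using n0 M1 by (intro mult_left_mono)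
    ultimately show ?thesis by simp
  qed
  \<comment> \<open>From \<open>p \<ge> 2\<close> follows \<open>1 \<le> 2 * ln p\<close>, which
    absorbs the additive constants. The constant is then 2 from the first term plus 3 times the
    \<open>4 * d\<close> in \<open>c\<close>.\<close>
  also have "\<dots> \<le> n * M * (2 * ln (real p)) + c * (3 * ln (real p))"
  proof -
    have "1 / 2 \<le> ln (2 :: real)" using ln2_ge_two_thirds by simp
    also have "\<dots> \<le> ln (real p)" using p2 by simp
    finally have "1 \<le> 2 * ln (real p)" by simp
    then show ?thesis
      using n0 M1 c0 mult_left_mono[of 1 "2 * ln (real p)" "n * M"]
        mult_left_mono[of "1 + ln (real p)" "3 * ln (real p)" c] by simp
  qed
  also have "\<dots> = (12 * real d + 2) * (n * M) * ln (real p)" by (simp add: c_def algebra_simps)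
  also have "n * M = real p powr (real d - 1 / real d)"
  proof -
    have "n = real p powr (real d - 1)" using p2 d by (simp add: n_def powr_realpow[symmetric] of_nat_diff)
    then show ?thesis by (simp add: M_def powr_add[symmetric])
  qed
  finally show "real (card {Q \<in> \<O>. toy_visible d p \<O> Q})
      \<le> (12 * real d + 2) * real p powr (real d - 1 / real d) * ln (real p)" .
qed

end
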